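(* Let $\mathcal{D}_{\mathcal{E}}$ be an unknown probability distribution over (static) environments, let $E_1,\dots,E_N$ be i.i.d. samples from $\mathcal{D}_{\mathcal{E}}$ (the calibration dataset), and let $\delta\in(0,1)$. For any user-specified safety tolerance $\epsilon\in(0,1)$, let $\hat\epsilon$ be such that, with $v:=\lfloor (N+1)\hat\epsilon\rfloor$ (where $1\le v\le N$), $\mathrm{Beta}^{-1}_{N+1-v,\,v}(\delta)\ge 1-\epsilon$; let $\hat q_{1-\epsilon}$ be the $\lceil (N+1)(1-\hat\epsilon)\rceil$-th smallest of the non-conformity scores $U_1,\dots,U_N$; and let $\tilde\phi$ be the calibrated perception system whose predicted occupied space in environment $E$ from state $s$ is $\overline{\mathcal{X}}^{\mathrm{occ}}_{s,E}(\hat q_{1-\epsilon})$. Then, with probability at least $1-\delta$ over the sampling of the calibration dataset, $\tilde\phi$ combined with any safe planner that chooses actions based on the outputs of the non-deterministic filter ensures end-to-end safety for the resulting overall policy $\pi^{\tilde\phi}$: $$C^{\mathrm{safe}}_{\mathcal{D}_{\mathcal{E}}}(\pi^{\tilde\phi}):=\mathbb{E}_{E\sim\mathcal{D}_{\mathcal{E}}}\big[C^{\mathrm{safe}}_E(\pi^{\tilde\phi})\big]\le\epsilon,$$ where the expectation is over a new environment $E$ independent of the calibration dataset, which is held fixed.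
   Context: Robot and environments. The robot has dynamics $s_{t+1}=f_E(s_t,a_t)$ with known states $s_t$ in a set $\mathcal{S}$, which for calibration and planning is taken to be finite and discrete (all states visited at perception time steps lie in $\mathcal{S}$), actions $a_t$, and a static environment $E$ with set $\mathcal{S}_{0,E}\subseteq\mathcal{S}$ of allowable initial states. Each state $s$ has a configuration $x(s)$ in the configuration space $\mathcal{X}_E$, and $\mathcal{X}^{\mathrm{occ}}_E\subseteq\mathcal{X}_E$ is the ground-truth occupied space. The time horizon is $t\in\{0,\dots,T\}$. Perception and scores. A pre-trained perception system $\phi$ yields, for each $E$ and $s\in\mathcal{S}$, predicted occupied sets $\overline{\mathcal{X}}^{\mathrm{occ}}_{s,E}(q)\subseteq\mathcal{X}_E$ depending on a real scaling parameter $q$, monotonically: $q\le q'$ implies $\overline{\mathcal{X}}^{\mathrm{occ}}_{s,E}(q)\subseteq\overline{\mathcal{X}}^{\mathrm{occ}}_{s,E}(q')$. The non-conformity score is $$U_E:=\min\{q:\ \mathcal{X}^{\mathrm{occ}}_E\subseteq\overline{\mathcal{X}}^{\mathrm{occ}}_{s,E}(q)\ \ \forall s\in\mathcal{S}\}$$ (the minimum being assumed to exist, and $U_E$ measurable), and $U_i:=U_{E_i}$. $\mathrm{Beta}^{-1}_{a,b}(\delta)$ is the $\delta$-quantile of the Beta distribution with parameters $a,b$. Non-deterministic filter. At each time $t$ the calibrated perception system returns $\hat{\mathcal{X}}^{\mathrm{occ}}_t:=\overline{\mathcal{X}}^{\mathrm{occ}}_{s_t,E}(\hat q_{1-\epsilon})$.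 The filter maintains a map $m_t=\{\overline{\mathcal{X}}^{\mathrm{free}}_t,\overline{\mathcal{X}}^{\mathrm{occ}}_t,\overline{\mathcal{X}}^{\mathrm{unknown}}_t\}$ partitioning $\mathcal{X}_E$. It is updated by $\overline{\mathcal{X}}^{\mathrm{occ}}_{t+1}=\overline{\mathcal{X}}^{\mathrm{occ}}_t\cap\hat{\mathcal{X}}^{\mathrm{occ}}_{t+1}$ and $\overline{\mathcal{X}}^{\mathrm{free}}_{t+1}=\overline{\mathcal{X}}^{\mathrm{free}}_t\cup\hat{\mathcal{X}}^{\mathrm{free}}_{t+1}$, initialized with $\overline{\mathcal{X}}^{\mathrm{occ}}_0=\hat{\mathcal{X}}^{\mathrm{occ}}_0$ and $\overline{\mathcal{X}}^{\mathrm{free}}_0=\hat{\mathcal{X}}^{\mathrm{free}}_0$. Here $\hat{\mathcal{X}}^{\mathrm{free}}_t$ is an estimate of free space computed from $\overline{\mathcal{X}}^{\mathrm{occ}}_t$ taking occlusion and limited field of view into account; in particular $\hat{\mathcal{X}}^{\mathrm{free}}_t\subseteq\mathcal{X}_E\setminus\overline{\mathcal{X}}^{\mathrm{occ}}_t$. Safe planner. A planner choosing actions from $m_t$ is safe if it never drives the robot outside the perceived free space: in every environment $E$, from every $s_0\in\mathcal{S}_{0,E}$, the closed-loop trajectory satisfies $x(s_t)\in\overline{\mathcal{X}}^{\mathrm{free}}_t$ for all $t\in\{0,\dots,T\}$. The composition of the sensor, $\tilde\phi$, the filter and the planner is the policy $\pi^{\tilde\phi}$. Safety cost. $C^{\mathrm{safe}}_E(\pi)\in\{0,1\}$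 equals $0$ if, from every initial state $s_0\in\mathcal{S}_{0,E}$, the policy $\pi$ avoids collision in $E$ over the whole horizon (i.e. $x(s_t)\notin\mathcal{X}^{\mathrm{occ}}_E$ for all $t\in\{0,\dots,T\}$), and equals $1$ otherwise. *)

theory Defs
  imports "HOL-Probability.Probability"
begin

section \<open>Robot, environments and perception\<close>

record ('e, 's, 'a, 'x) robot_system =
  envs :: "'e set"
  state_space :: "'s set"
  init_states :: "'e \<Rightarrow> 's set"
  dyn :: "'e \<Rightarrow> 's \<Rightarrow> 'a \<Rightarrow> 's"
  cspace :: "'e \<Rightarrow> 'x set"
  config :: "'s \<Rightarrow> 'x"
  true_occ :: "'e \<Rightarrow> 'x set"
  horizon :: nat
  pred_occ :: "'e \<Rightarrow> 's \<Rightarrow> real \<Rightarrow> 'x set"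
  free_est :: "'e \<Rightarrow> 's \<Rightarrow> 'x set \<Rightarrow> 'x set"

text \<open>
  \<open>pred_occ R E s q\<close> is the occupied set predicted from state \<open>s\<close> with scaling
  parameter \<open>q\<close>. \<open>free_est R E s Z\<close> is the free space that is visible from \<open>s\<close> in \<open>E\<close>
  when \<open>Z\<close> is regarded as occupied; of the occlusion and field-of-view computation only
  \<open>free_est R E s Z \<subseteq> cspace R E - Z\<close> is specified.
\<close>

definition covers :: "('e, 's, 'a, 'x) robot_system \<Rightarrow> 'e \<Rightarrow> real \<Rightarrow> bool" where
  "covers R E q \<longleftrightarrow> (\<forall>s\<in>state_space R. true_occ R E \<subseteq> pred_occ R E s q)"

definition nonconformity :: "('e, 's, 'a, 'x) robot_system \<Rightarrow> 'e \<Rightarrow> real" where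
  "nonconformity R E = (LEAST q. covers R E q)"

definition valid_system :: "('e, 's, 'a, 'x) robot_system \<Rightarrow> bool" where
  "valid_system R \<longleftrightarrow>
     finite (state_space R) \<and>
     (\<forall>E\<in>envs R.
        init_states R E \<subseteq> state_space R \<and>
        (\<forall>s\<in>state_space R. \<forall>a. dyn R E s a \<in> state_space R) \<and>
        (\<forall>s\<in>state_space R. config R s \<in> cspace R E) \<and>
        true_occ R E \<subseteq> cspace R E \<and>
        (\<forall>s\<in>state_space R. \<forall>q. pred_occ R E s q \<subseteq> cspace R E) \<and>
        (\<forall>s\<in>state_space R. \<forall>q q'. q \<le> q' \<longrightarrow> pred_occ R E s q \<subseteq> pred_occ R E s q') \<and>
        (\<exists>q. covers R E q \<and> (\<forall>q'. covers R E q' \<longrightarrow> q \<le> q')) \<and>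
        (\<forall>s\<in>state_space R. \<forall>Z\<subseteq>cspace R E. free_est R E s Z \<subseteq> cspace R E - Z))"

definition calibrated_perception ::
    "('e, 's, 'a, 'x) robot_system \<Rightarrow> real \<Rightarrow> 'e \<Rightarrow> 's \<Rightarrow> 'x set" where
  "calibrated_perception R q = (\<lambda>E s. pred_occ R E s q)"


section \<open>Closed loop and safety cost\<close>

text \<open>
  A policy maps the environment (which it accesses only through its sensor) and the history
  \<open>[s\<^sub>0, \<dots>, s\<^sub>t]\<close> of visited states to the action \<open>a\<^sub>t\<close>; the history is needed because the
  filter has memory.
\<close>

type_synonym ('e, 's, 'a) policy = "'e \<Rightarrow> 's list \<Rightarrow> 'a"

primrec state_history ::
    "('e, 's, 'a, 'x) robot_system \<Rightarrow> ('e, 's, 'a) policy \<Rightarrow> 'e \<Rightarrow> 's \<Rightarrow> nat \<Rightarrow> 's list" where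
  "state_history R \<pi> E s0 0 = [s0]"
| "state_history R \<pi> E s0 (Suc t) =
     (let h = state_history R \<pi> E s0 t in h @ [dyn R E (last h) (\<pi> E h)])"

definition trajectory ::
    "('e, 's, 'a, 'x) robot_system \<Rightarrow> ('e, 's, 'a) policy \<Rightarrow> 'e \<Rightarrow> 's \<Rightarrow> nat \<Rightarrow> 's" where
  "trajectory R \<pi> E s0 t = last (state_history R \<pi> E s0 t)"

definition safe_cost ::
    "('e, 's, 'a, 'x) robot_system \<Rightarrow> ('e, 's, 'a) policy \<Rightarrow> 'e \<Rightarrow> real" where
  "safe_cost R \<pi> E =
     (if \<forall>s0\<in>init_states R E. \<forall>t\<le>horizon R. config R (trajectory R \<pi> E s0 t) \<notin> true_occ R E
      then 0 else 1)"


section \<open>Non-deterministic filter and safe planners\<close>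

record 'x occupancy_map =
  map_free :: "'x set"
  map_occ :: "'x set"
  map_unknown :: "'x set"

text \<open>
  The filter is run in environment \<open>E\<close> along a state sequence \<open>s\<close> with perception \<open>\<phi>\<close>;
  its value at time \<open>t\<close> depends on \<open>s 0, \<dots>, s t\<close> only.
\<close>

primrec filter_occ :: "('e \<Rightarrow> 's \<Rightarrow> 'x set) \<Rightarrow> 'e \<Rightarrow> (nat \<Rightarrow> 's) \<Rightarrow> nat \<Rightarrow> 'x set" where
  "filter_occ \<phi> E s 0 = \<phi> E (s 0)"
| "filter_occ \<phi> E s (Suc t) = filter_occ \<phi> E s t \<inter> \<phi> E (s (Suc t))"

primrec filter_free ::
    "('e, 's, 'a, 'x) robot_system \<Rightarrow> ('e \<Rightarrow> 's \<Rightarrow> 'x set) \<Rightarrow> 'e \<Rightarrow> (nat \<Rightarrow> 's) \<Rightarrow> nat \<Rightarrow> 'x set" where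
  "filter_free R \<phi> E s 0 = free_est R E (s 0) (filter_occ \<phi> E s 0)"
| "filter_free R \<phi> E s (Suc t) =
     filter_free R \<phi> E s t \<union> free_est R E (s (Suc t)) (filter_occ \<phi> E s (Suc t))"

definition filter_map ::
    "('e, 's, 'a, 'x) robot_system \<Rightarrow> ('e \<Rightarrow> 's \<Rightarrow> 'x set) \<Rightarrow> 'e \<Rightarrow> (nat \<Rightarrow> 's) \<Rightarrow> nat
      \<Rightarrow> 'x occupancy_map" where
  "filter_map R \<phi> E s t =
     \<lparr>map_free = filter_free R \<phi> E s t,
      map_occ = filter_occ \<phi> E s t,
      map_unknown = cspace R E - (filter_free R \<phi> E s t \<union> filter_occ \<phi> E s t)\<rparr>"

text \<open>
  A planner chooses \<open>a\<^sub>t\<close> from the list of known states and filter outputs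
  \<open>[(s\<^sub>0, m\<^sub>0), \<dots>, (s\<^sub>t, m\<^sub>t)]\<close>; planners that only use \<open>m\<^sub>t\<close> are the special case that looks
  at the last entry.
\<close>

type_synonym ('s, 'a, 'x) planner = "('s \<times> 'x occupancy_map) list \<Rightarrow> 'a"

definition composed_policy ::
    "('e, 's, 'a, 'x) robot_system \<Rightarrow> ('e \<Rightarrow> 's \<Rightarrow> 'x set) \<Rightarrow> ('s, 'a, 'x) planner
      \<Rightarrow> ('e, 's, 'a) policy" where
  "composed_policy R \<phi> p =
     (\<lambda>E h. p (map (\<lambda>i. (h ! i, filter_map R \<phi> E ((!) h) i)) [0..<length h]))"

definition safe_planner ::
    "('e, 's, 'a, 'x) robot_system \<Rightarrow> ('e \<Rightarrow> 's \<Rightarrow> 'x set) \<Rightarrow> ('s, 'a, 'x) planner \<Rightarrow> bool" where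
  "safe_planner R \<phi> p \<longleftrightarrow>
     (\<forall>E\<in>envs R. \<forall>s0\<in>init_states R E. \<forall>t\<le>horizon R.
        let s = trajectory R (composed_policy R \<phi> p) E s0
        in config R (s t) \<in> map_free (filter_map R \<phi> E s t))"


section \<open>Beta distribution, quantiles and order statistics\<close>

definition beta_distribution :: "real \<Rightarrow> real \<Rightarrow> real measure" where
  "beta_distribution a b =
     density lborel
       (\<lambda>x. ennreal (indicator {0<..<1} x * (x powr (a - 1) * (1 - x) powr (b - 1) / Beta a b)))"

definition quantile :: "real measure \<Rightarrow> real \<Rightarrow> real" where
  "quantile M p = Inf {x. p \<le> cdf M x}"

text \<open>The \<open>k\<close>-th smallest entry, counted from 1 and with multiplicity.\<close>

definition kth_smallest :: "nat \<Rightarrow> real list \<Rightarrow> real" where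
  "kth_smallest k xs = sort xs ! (k - 1)"

definition calibrated_threshold ::
    "('e, 's, 'a, 'x) robot_system \<Rightarrow> nat \<Rightarrow> real \<Rightarrow> (nat \<Rightarrow> 'e) \<Rightarrow> real" where
  "calibrated_threshold R N \<epsilon>' Es =
     kth_smallest (nat \<lceil>(real N + 1) * (1 - \<epsilon>')\<rceil>) (map (\<lambda>i. nonconformity R (Es i)) [1..<N + 1])"

end

theory Submission
  imports Defs
begin

text \<open>
  If the threshold \<open>q\<close> is at least the score of \<open>E\<close>, every predicted occupied set contains the
  true one, so all estimated free space is really free and a safe planner does not collide. The
  cost of \<open>E\<close> is therefore at most the indicator of \<open>U\<^sub>E > q\<close>, whose expectation is \<open>1 - F q\<close> for
  the distribution function \<open>F\<close> of the scores. With \<open>k = N + 1 - v\<close>, the \<open>k\<close>-th smallest score \<open>q\<close>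
  has \<open>F q < 1 - \<epsilon>\<close> only if at least \<open>k\<close> of the \<open>N\<close> scores lie in the down-set
  \<open>{x. F x < 1 - \<epsilon>}\<close>, which has probability at most \<open>1 - \<epsilon>\<close>. By monotonicity of the binomial tail in
  the success probability, and because that tail is the distribution function of the Beta
  distribution with parameters \<open>k\<close> and \<open>v\<close>, this happens with probability at most \<open>\<delta>\<close>.
\<close>

section \<open>Closed-loop safety when predictions cover the true occupied space\<close>

lemma valid_systemD:
  assumes "valid_system R" "E \<in> envs R"
  shows "init_states R E \<subseteq> state_space R"
    and "s \<in> state_space R \<Longrightarrow> dyn R E s a \<in> state_space R"
    and "s \<in> state_space R \<Longrightarrow> pred_occ R E s q \<subseteq> cspace R E"
    and "s \<in> state_space R \<Longrightarrow> q \<le> q' \<Longrightarrow> pred_occ R E s q \<subseteq> pred_occ R E s q'"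
    and "\<exists>q. covers R E q \<and> (\<forall>q'. covers R E q' \<longrightarrow> q \<le> q')"
    and "s \<in> state_space R \<Longrightarrow> Z \<subseteq> cspace R E \<Longrightarrow> free_est R E s Z \<subseteq> cspace R E - Z"
  using assms(1)[unfolded valid_system_def, THEN conjunct2, THEN bspec, OF assms(2)] by simp_all

lemma trajectory_0: "trajectory R \<pi> E s0 0 = s0"
  by (simp add: trajectory_def)

lemma trajectory_Suc:
  "trajectory R \<pi> E s0 (Suc t) =
     dyn R E (trajectory R \<pi> E s0 t) (\<pi> E (state_history R \<pi> E s0 t))"
  by (simp add: trajectory_def Let_def)

lemma trajectory_in_state_space:
  assumes "valid_system R" "E \<in> envs R" "s0 \<in> init_states R E"
  shows "trajectory R \<pi> E s0 t \<in> state_space R"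
proof (induction t)
  case 0
  show ?case using valid_systemD(1)[OF assms(1,2)] assms(3) by (auto simp: trajectory_0)
next
  case (Suc t)
  then show ?case unfolding trajectory_Suc by (rule valid_systemD(2)[OF assms(1,2)])
qed

text \<open>\<open>valid_system\<close> provides an attained minimum, so \<open>LEAST\<close> really
  denotes a covering parameter; monotonicity of the predictions carries coverage from there up to
  \<open>q\<close>.\<close>

lemma nonconformity_le_imp_covers:
  assumes "valid_system R" "E \<in> envs R" "nonconformity R E \<le> q"
  shows "covers R E q"
proof -
  obtain m where m: "covers R E m" "\<And>q'. covers R E q' \<Longrightarrow> m \<le> q'"
    using valid_systemD(5)[OF assms(1,2)] by blast
  then have "nonconformity R E = m"
    unfolding nonconformity_def by (intro Least_equality) auto
  with assms(3) have "m \<le> q" by simp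
  then have "\<forall>s\<in>state_space R. pred_occ R E s m \<subseteq> pred_occ R E s q"
    using valid_systemD(4)[OF assms(1,2)] by blast
  with m(1) show ?thesis unfolding covers_def by blast
qed

lemma filter_occ_bounds:
  assumes "\<And>t. A \<subseteq> \<phi> E (s t)" "\<And>t. \<phi> E (s t) \<subseteq> C"
  shows "A \<subseteq> filter_occ \<phi> E s t" "filter_occ \<phi> E s t \<subseteq> C"
  using assms by (induction t) auto

text \<open>Intersecting predictions that all contain the true occupied space loses none of it, so
  every single free estimate avoids that space. The filter only takes unions of such
  estimates.\<close>

lemma filter_free_disjoint_true_occ:
  assumes "valid_system R" "E \<in> envs R" "covers R E q" "\<And>t. s t \<in> state_space R"
  shows "filter_free R (calibrated_perception R q) E s t \<inter> true_occ R E = {}"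
proof -
  let ?occ = "filter_occ (calibrated_perception R q) E s"
  \<comment> \<open>The lower bound is the point of coverage; the upper bound is there because
    \<open>free_est\<close> is specified only for occupied sets inside
    \<open>cspace\<close>.\<close>
  have "true_occ R E \<subseteq> ?occ t" "?occ t \<subseteq> cspace R E" for t
  proof -
    have "true_occ R E \<subseteq> calibrated_perception R q E (s t)"
      "calibrated_perception R q E (s t) \<subseteq> cspace R E" for t
      using assms(3,4) valid_systemD(3)[OF assms(1,2) assms(4)]
      unfolding calibrated_perception_def covers_def by auto
    then show "true_occ R E \<subseteq> ?occ t" "?occ t \<subseteq> cspace R E"
      by (rule filter_occ_bounds)+
  qed
  moreover have "free_est R E (s t) Z \<subseteq> cspace R E - Z" if "Z \<subseteq> cspace R E" for t Z
    using valid_systemD(6)[OF assms(1,2) assms(4) that] .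
  ultimately have *: "free_est R E (s t) (?occ t) \<inter> true_occ R E = {}" for t
    by blast
  show ?thesis
  proof (induction t)
    case 0
    show ?case using *[of 0] by simp
  next
    case (Suc t)
    then show ?case using *[of "Suc t"] by (simp add: Int_Un_distrib2)
  qed
qed

lemma safe_cost_eq_0:
  assumes R: "valid_system R" and E: "E \<in> envs R" and "nonconformity R E \<le> q"
    and p: "safe_planner R (calibrated_perception R q) p"
  shows "safe_cost R (composed_policy R (calibrated_perception R q) p) E = 0"
proof -
  let ?\<phi> = "calibrated_perception R q"
  have cov: "covers R E q" by (rule nonconformity_le_imp_covers) fact+
  have "config R (trajectory R (composed_policy R ?\<phi> p) E s0 t) \<notin> true_occ R E"
    if s0: "s0 \<in> init_states R E" and t: "t \<le> horizon R" for s0 t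
  proof -
    let ?s = "trajectory R (composed_policy R ?\<phi> p) E s0"
    have "config R (?s t) \<in> filter_free R ?\<phi> E ?s t"
      using p E s0 t unfolding safe_planner_def Let_def filter_map_def by simp
    moreover have "filter_free R ?\<phi> E ?s t \<inter> true_occ R E = {}"
      by (intro filter_free_disjoint_true_occ R E cov trajectory_in_state_space s0)
    ultimately show ?thesis by blast
  qed
  then show ?thesis unfolding safe_cost_def by simp
qed

section \<open>Rank of the threshold and order statistics\<close>

lemma nat_ceiling_one_minus:
  assumes "int v = \<lfloor>(real N + 1) * e\<rfloor>"
  shows "nat \<lceil>(real N + 1) * (1 - e)\<rceil> = N + 1 - v"
proof -
  \<comment> \<open>As \<open>N + 1\<close> is an integer, the ceiling of \<open>N + 1\<close> minus
    a real is \<open>N + 1\<close> minus its floor. Hence the rank agrees with the first Beta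
    parameter.\<close>
  have "(real N + 1) * (1 - e) = of_int (int N + 1) - (real N + 1) * e"
    by (simp add: algebra_simps)
  then have "\<lceil>(real N + 1) * (1 - e)\<rceil> = int N + 1 - int v"
    using assms by linarith
  then show ?thesis by linarith
qed

text \<open>Otherwise the first \<open>k\<close> entries of the sorted list, none above the last of
  them, would all lie in \<open>I\<close>; sorting does not change the count. Ties are counted with
  multiplicity throughout.\<close>

lemma kth_smallest_not_in_downset:
  assumes "1 \<le> k" "k \<le> length xs"
    and down: "\<And>x y. x \<in> I \<Longrightarrow> y \<le> x \<Longrightarrow> y \<in> I"
    and few: "length (filter (\<lambda>x. x \<in> I) xs) < k"
  shows "kth_smallest k xs \<notin> I"
proof
  assume *: "kth_smallest k xs \<in> I"
  have "x \<in> I" if x: "x \<in> set (take k (sort xs))" for x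
  proof -
    from x obtain i where i: "i < k" "i < length xs" "x = sort xs ! i"
      by (auto simp: in_set_conv_nth)
    then have "x \<le> sort xs ! (k - 1)"
      using assms(2) by (auto intro!: sorted_nth_mono)
    with * down show ?thesis unfolding kth_smallest_def by blast
  qed
  then have "filter (\<lambda>x. x \<in> I) (take k (sort xs)) = take k (sort xs)"
    by (simp add: filter_id_conv)
  moreover have "length (filter (\<lambda>x. x \<in> I) (sort xs)) \<ge>
      length (filter (\<lambda>x. x \<in> I) (take k (sort xs)))"
    by (metis append_take_drop_id filter_append le_add1 length_append)
  moreover have "length (filter (\<lambda>x. x \<in> I) (sort xs)) = length (filter (\<lambda>x. x \<in> I) xs)"
    by (metis mset_filter mset_sort size_mset)
  ultimately show False using few assms(2) by simp
qed

section \<open>Binomial tails and counts of independent events\<close>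

definition binomial_tail :: "nat \<Rightarrow> nat \<Rightarrow> real \<Rightarrow> real" where
  "binomial_tail n k p = (\<Sum>j=k..n. real (n choose j) * p ^ j * (1 - p) ^ (n - j))"

lemma binomial_tail_0: "1 \<le> k \<Longrightarrow> binomial_tail n k 0 = 0"
  unfolding binomial_tail_def by (intro sum.neutral) (auto simp: power_0_left)

text \<open>The termwise derivatives telescope, leaving only one term. The induction runs downwards
  from \<open>k = Suc n\<close>, where the sum is empty and \<open>n choose k\<close> is 0.\<close>

lemma has_real_derivative_binomial_tail:
  assumes "1 \<le> k" "k \<le> Suc n"
  shows "(binomial_tail n k has_real_derivative
           real k * real (n choose k) * p ^ (k - 1) * (1 - p) ^ (n - k)) (at p)"
  using assms(2,1)
proof (induction k rule: inc_induct)
  case base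
  show ?case unfolding binomial_tail_def by (simp add: binomial_eq_0)
next
  case (step k)
  have tail: "binomial_tail n k =
      (\<lambda>p. real (n choose k) * (p ^ k * (1 - p) ^ (n - k)) + binomial_tail n (Suc k) p)"
    using step.hyps unfolding binomial_tail_def
    by (auto simp: sum.atLeast_Suc_atMost[of k n] algebra_simps)
  \<comment> \<open>Both sides equal \<open>n * ((n - 1) choose k)\<close>. This makes the
    derivative of the tail from \<open>Suc k\<close> cancel the negative part of the derivative of
    term \<open>k\<close>.\<close>
  have choose: "real (Suc k) * real (n choose Suc k) = real (n - k) * real (n choose k)"
    by (simp only: of_nat_mult[symmetric] binomial_absorption binomial_absorb_comp)
  have IH: "(binomial_tail n (Suc k) has_real_derivative
      real (Suc k) * real (n choose Suc k) * p ^ k * (1 - p) ^ (n - Suc k)) (at p)"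
    using step.IH by simp
  have "(binomial_tail n k has_real_derivative
      real (n choose k) * (real k * p ^ (k - 1) * (1 - p) ^ (n - k) -
        p ^ k * (real (n - k) * (1 - p) ^ (n - k - 1))) +
      real (Suc k) * real (n choose Suc k) * p ^ k * (1 - p) ^ (n - Suc k)) (at p)"
    unfolding tail by (rule DERIV_add[OF _ IH]) (auto intro!: derivative_eq_intros simp: algebra_simps)
  then show ?case
    unfolding choose by (simp add: algebra_simps)
qed

lemma binomial_tail_mono:
  assumes "1 \<le> k" "k \<le> n" "0 \<le> p" "p \<le> q" "q \<le> 1"
  shows "binomial_tail n k p \<le> binomial_tail n k q"
proof (rule DERIV_nonneg_imp_nondecreasing[where f = "binomial_tail n k"])
  fix x assume x: "p \<le> x" "x \<le> q"
  show "\<exists>y. (binomial_tail n k has_real_derivative y) (at x) \<and> 0 \<le> y"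
    using assms x
    by (intro exI[of _ "real k * real (n choose k) * x ^ (k - 1) * (1 - x) ^ (n - k)"] conjI
        has_real_derivative_binomial_tail) auto
qed fact

text \<open>The event splits into disjoint pieces \<open>F S\<close> according to the exact set
  \<open>S\<close> of indices that hit \<open>B\<close>. Independence makes each piece a product
  depending only on \<open>card S\<close>; grouping by cardinality produces the binomial
  coefficients.\<close>

lemma (in prob_space) prob_count_ge_eq_binomial_tail:
  assumes indep: "indep_vars (\<lambda>_. D) X I" and I: "finite I" "I \<noteq> {}"
    and B: "B \<in> sets D"
    and p: "\<And>i. i \<in> I \<Longrightarrow> prob (X i -` B \<inter> space M) = p"
  shows "{\<omega>\<in>space M. k \<le> card {i\<in>I. X i \<omega> \<in> B}} \<in> events"
    and "prob {\<omega>\<in>space M. k \<le> card {i\<in>I. X i \<omega> \<in> B}} = binomial_tail (card I) k p"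
proof -
  have X: "X i \<in> measurable M D" if "i \<in> I" for i
    using indep that unfolding indep_vars_def by blast
  \<comment> \<open>An intersection over an empty \<open>I\<close> would be the whole type;
    \<open>I \<noteq> {}\<close> keeps \<open>F S\<close> inside \<open>space M\<close>.\<close>
  define F where "F S = (\<Inter>i\<in>I. X i -` (if i \<in> S then B else space D - B) \<inter> space M)" for S
  have F_eq: "F S = {\<omega>\<in>space M. {i\<in>I. X i \<omega> \<in> B} = S}" if "S \<subseteq> I" for S
  proof (intro equalityI subsetI)
    fix \<omega> assume \<omega>: "\<omega> \<in> F S"
    then have "\<omega> \<in> space M" using I(2) unfolding F_def by blast
    moreover have "X i \<omega> \<in> B \<longleftrightarrow> i \<in> S" if i: "i \<in> I" for i
    proof -
      have "X i \<omega> \<in> (if i \<in> S then B else space D - B)" using \<omega> i unfolding F_def by blast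
      then show ?thesis by (auto split: if_splits)
    qed
    ultimately show "\<omega> \<in> {\<omega>\<in>space M. {i\<in>I. X i \<omega> \<in> B} = S}"
      using that by auto
  next
    fix \<omega> assume "\<omega> \<in> {\<omega>\<in>space M. {i\<in>I. X i \<omega> \<in> B} = S}"
    then show "\<omega> \<in> F S"
      using measurable_space[OF X] unfolding F_def by auto
  qed
  have F_sets: "F S \<in> events" for S
    unfolding F_def using I B by (intro sets.finite_INT measurable_sets[OF X]) auto
  have F_prob: "prob (F S) = p ^ card S * (1 - p) ^ (card I - card S)" if S: "S \<subseteq> I" for S
  proof -
    have co: "prob (X i -` (space D - B) \<inter> space M) = 1 - p" if i: "i \<in> I" for i
    proof -
      have "X i -` (space D - B) \<inter> space M = space M - (X i -` B \<inter> space M)"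
        using measurable_space[OF X[OF i]] by auto
      then show ?thesis using p[OF i] prob_compl[OF measurable_sets[OF X[OF i] B]] by simp
    qed
    have "prob (F S) = (\<Prod>i\<in>I. prob (X i -` (if i \<in> S then B else space D - B) \<inter> space M))"
      unfolding F_def using I B by (intro indep_varsD_finite[OF indep]) auto
    also have "\<dots> = (\<Prod>i\<in>I. if i \<in> S then p else 1 - p)"
      using p co by (intro prod.cong) auto
    also have "\<dots> = p ^ card S * (1 - p) ^ card (I - S)"
      using S I by (simp add: prod.If_cases Int_absorb1 Diff_eq)
    finally show ?thesis using S I by (simp add: card_Diff_subset finite_subset)
  qed
  let ?\<S> = "{S. S \<subseteq> I \<and> k \<le> card S}"
  have fin: "finite ?\<S>" using I by simp
  have event: "{\<omega>\<in>space M. k \<le> card {i\<in>I. X i \<omega> \<in> B}} = (\<Union>S\<in>?\<S>. F S)"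
    using F_eq by auto
  show "{\<omega>\<in>space M. k \<le> card {i\<in>I. X i \<omega> \<in> B}} \<in> events"
    unfolding event using F_sets fin by (intro sets.finite_UN) auto
  have "prob (\<Union>S\<in>?\<S>. F S) = (\<Sum>S\<in>?\<S>. prob (F S))"
  proof (intro finite_measure_finite_Union fin)
    show "disjoint_family_on F ?\<S>" using F_eq by (auto simp: disjoint_family_on_def)
  qed (use F_sets in blast)
  also have "\<dots> = (\<Sum>S\<in>?\<S>. p ^ card S * (1 - p) ^ (card I - card S))"
    using F_prob by (intro sum.cong) auto
  also have "\<dots> = (\<Sum>j=k..card I. \<Sum>S\<in>{S\<in>?\<S>. card S = j}. p ^ card S * (1 - p) ^ (card I - card S))"
    using card_mono[OF I(1)] by (intro sum.group[symmetric] fin finite_atLeastAtMost) auto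
  also have "\<dots> = binomial_tail (card I) k p"
    unfolding binomial_tail_def
  proof (intro sum.cong refl)
    fix j assume j: "j \<in> {k..card I}"
    then have "{S\<in>?\<S>. card S = j} = {S. S \<subseteq> I \<and> card S = j}" by auto
    then have "card {S\<in>?\<S>. card S = j} = card I choose j" using n_subsets[OF I(1)] by simp
    moreover have "(\<Sum>S\<in>{S\<in>?\<S>. card S = j}. p ^ card S * (1 - p) ^ (card I - card S)) =
        (\<Sum>S\<in>{S\<in>?\<S>. card S = j}. p ^ j * (1 - p) ^ (card I - j))"
      by (intro sum.cong) auto
    ultimately show "(\<Sum>S\<in>{S\<in>?\<S>. card S = j}. p ^ card S * (1 - p) ^ (card I - card S)) =
        real (card I choose j) * p ^ j * (1 - p) ^ (card I - j)"
      by simp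
  qed
  finally show "prob {\<omega>\<in>space M. k \<le> card {i\<in>I. X i \<omega> \<in> B}} = binomial_tail (card I) k p"
    unfolding event .
qed

section \<open>Beta distributions with integer parameters and their quantiles\<close>

lemma inverse_Beta_nat:
  assumes "1 \<le> k" "k \<le> n"
  shows "1 / Beta (real k) (real (n + 1 - k)) = real k * real (n choose k)"
proof -
  obtain j where k: "k = Suc j" using assms(1) by (cases k) auto
  have "Gamma (real k) = fact j" using Gamma_fact[of j, where 'a = real] by (simp add: k add_ac)
  moreover have "Gamma (real (n + 1 - k)) = fact (n - k)"
    using Gamma_fact[of "n - k", where 'a = real] assms(2) by (simp add: of_nat_diff algebra_simps)
  moreover have "real k + real (n + 1 - k) = 1 + real n" using assms(2) by (simp add: of_nat_diff)
  then have "Gamma (real k + real (n + 1 - k)) = fact n"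
    using Gamma_fact[of n, where 'a = real] by simp
  moreover have "fact k = real k * fact j" by (simp add: k)
  ultimately show ?thesis
    using assms by (simp add: Beta_def binomial_fact k)
qed

text \<open>By \<open>inverse_Beta_nat\<close> the Beta density on the open unit interval is the
  derivative of the binomial tail, which vanishes at 0; the fundamental theorem of calculus does the
  rest.\<close>

lemma cdf_beta_distribution:
  assumes "1 \<le> k" "k \<le> n" "0 \<le> x" "x \<le> 1"
  shows "cdf (beta_distribution (real k) (real (n + 1 - k))) x = binomial_tail n k x"
proof -
  let ?f = "\<lambda>y. real k * real (n choose k) * y ^ (k - 1) * (1 - y) ^ (n - k)"
  let ?g = "\<lambda>y. indicator {0<..<1} y * (y powr (real k - 1) *
      (1 - y) powr (real (n + 1 - k) - 1) / Beta (real k) (real (n + 1 - k)))"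
  have fg: "?g y = ?f y" if "0 < y" "y < 1" for y
  proof -
    have "y powr (real k - 1) = y ^ (k - 1)"
      using that assms(1) by (simp add: powr_realpow[symmetric] of_nat_diff)
    moreover have "(1 - y) powr (real (n + 1 - k) - 1) = (1 - y) ^ (n - k)"
      using that assms(2) by (simp add: powr_realpow[symmetric] of_nat_diff)
    ultimately show ?thesis
      using that inverse_Beta_nat[OF assms(1,2)] by (simp add: divide_inverse mult_ac)
  qed
  have "emeasure (beta_distribution (real k) (real (n + 1 - k))) {..x} =
      (\<integral>\<^sup>+y. ennreal (?g y) * indicator {..x} y \<partial>lborel)"
    unfolding beta_distribution_def by (subst emeasure_density) auto
  also have "\<dots> = (\<integral>\<^sup>+y. ennreal (?f y) * indicator {0..x} y \<partial>lborel)"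
  proof (rule nn_integral_cong_AE)
    \<comment> \<open>At 0 and 1 the density is set to 0 while the polynomial may be positive (for
      \<open>k = 1\<close> or \<open>k = n\<close>), so the integrands are compared off this null
      set.\<close>
    have "AE y in lborel. y \<noteq> 0 \<and> y \<noteq> (1::real)"
      using AE_lborel_singleton[of "0::real"] AE_lborel_singleton[of "1::real"] by eventually_elim auto
    then show "AE y in lborel. ennreal (?g y) * indicator {..x} y = ennreal (?f y) * indicator {0..x} y"
    proof eventually_elim
      case (elim y)
      show ?case
      proof (cases "0 < y \<and> y < 1")
        case True
        then have "indicator {..x} y = (indicator {0..x} y :: ennreal)"
          by (auto simp: indicator_def)
        then show ?thesis using fg[of y] True by simp
      next
        case False
        then show ?thesis using elim assms by (auto simp: indicator_def)
      qed
    qed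
  qed
  also have "\<dots> = binomial_tail n k x - binomial_tail n k 0"
  proof (rule nn_integral_FTC_Icc)
    show "(binomial_tail n k has_real_derivative ?f y) (at y)" for y
      using assms by (intro has_real_derivative_binomial_tail) auto
    show "0 \<le> ?f y" if "y \<in> {0..x}" for y using that assms by auto
  qed (use assms in auto)
  finally show ?thesis
    using assms binomial_tail_mono[OF assms(1,2), of 0 x]
    unfolding cdf_def measure_def by (simp add: binomial_tail_0)
qed

lemma cdf_beta_distribution_neg:
  assumes "x < 0"
  shows "cdf (beta_distribution a b) x = 0"
proof -
  have "emeasure (beta_distribution a b) {..x} =
      (\<integral>\<^sup>+y. ennreal (indicator {0<..<1} y * (y powr (a - 1) * (1 - y) powr (b - 1) / Beta a b)) *
        indicator {..x} y \<partial>lborel)"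
    unfolding beta_distribution_def by (subst emeasure_density) auto
  also have "\<dots> = (\<integral>\<^sup>+y. 0 \<partial>(lborel :: real measure))"
    using assms by (intro nn_integral_cong) (auto simp: indicator_def)
  finally show ?thesis unfolding cdf_def measure_def by simp
qed

text \<open>Strictly below the quantile the distribution function is less than \<delta>. As
  \<open>c\<close> may equal the quantile, the bound at \<open>c\<close> itself comes from
  continuity, by a limit from the left.\<close>

lemma binomial_tail_le_of_beta_quantile:
  assumes "1 \<le> k" "k \<le> n" "0 < \<delta>" "0 < c" "c < 1"
    and quant: "c \<le> quantile (beta_distribution (real k) (real (n + 1 - k))) \<delta>"
  shows "binomial_tail n k c \<le> \<delta>"
proof -
  let ?\<beta> = "beta_distribution (real k) (real (n + 1 - k))"
  \<comment> \<open>A real infimum bounds its members only if the set is bounded below; 0 serves,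
    since the distribution function vanishes on negative reals and \<delta> is positive.\<close>
  have "bdd_below {x. \<delta> \<le> cdf ?\<beta> x}"
  proof (rule bdd_belowI[of _ 0])
    fix x assume "x \<in> {x. \<delta> \<le> cdf ?\<beta> x}"
    then show "0 \<le> x"
      using cdf_beta_distribution_neg[of x] assms(3) by (cases "x < 0") auto
  qed
  then have cdf_less: "cdf ?\<beta> x < \<delta>" if "x < c" for x
    using that quant cInf_lower[of x "{x. \<delta> \<le> cdf ?\<beta> x}"] unfolding quantile_def
    by (cases "\<delta> \<le> cdf ?\<beta> x") auto
  have "binomial_tail n k x \<le> \<delta>" if "0 < x" "x < c" for x
    using cdf_beta_distribution[OF assms(1,2), of x] cdf_less[of x] that assms(5)
    by simp
  then have "eventually (\<lambda>x. binomial_tail n k x \<le> \<delta>) (at_left c)"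
    using eventually_at_left_real[OF assms(4)] by (auto elim: eventually_mono)
  moreover have "isCont (binomial_tail n k) c"
    using has_real_derivative_binomial_tail[of k n c] assms(1,2) by (auto intro: DERIV_isCont)
  then have "(binomial_tail n k \<longlongrightarrow> binomial_tail n k c) (at_left c)"
    by (simp add: isCont_def filterlim_at_split)
  ultimately show ?thesis
    by (intro tendsto_upperbound) auto
qed

section \<open>Score distribution and the calibrated safety bound\<close>

lemma (in real_distribution) measure_cdf_less_le:
  assumes "0 \<le> c" "c \<le> 1"
  shows "measure M {x. cdf M x < c} \<le> c"
\<comment> \<open>These cases are split off because the argument uses the supremum: the set must be
  nonempty, and for \<open>c = 1\<close> it may be unbounded above.\<close>
proof (cases "{x. cdf M x < c} = {} \<or> c = 1")
  case True
  then show ?thesis using assms by auto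
next
  case False
  let ?I = "{x. cdf M x < c}"
  have "eventually (\<lambda>x. c < cdf M x) at_top"
    using False assms by (intro order_tendstoD(1)[OF cdf_lim_at_top_prob]) auto
  then obtain b where b: "c < cdf M b" by (auto simp: eventually_at_top_linorder)
  have bdd: "bdd_above ?I"
  proof (rule bdd_aboveI[of _ b])
    fix x assume "x \<in> ?I"
    then show "x \<le> b" using b cdf_nondecreasing[of b x] by (cases "x \<le> b") auto
  qed
  have below: "cdf M x < c" if "x < Sup ?I" for x
  proof -
    obtain y where "y \<in> ?I" "x < y" using less_cSup_iff[OF _ bdd] False \<open>x < Sup ?I\<close> by blast
    then show ?thesis using cdf_nondecreasing[of x y] by simp
  qed
  show ?thesis
  \<comment> \<open>A down-set is a half-line, closed or open at its supremum. Closed, its measure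
    is a value of \<open>cdf\<close> below \<open>c\<close>; open, it is a left limit of such
    values. Atoms of the score distribution are thus covered.\<close>
  proof (cases "Sup ?I \<in> ?I")
    case True
    have "measure M ?I \<le> measure M {..Sup ?I}"
      using bdd by (intro finite_measure_mono) (auto intro: cSup_upper)
    with True show ?thesis by (simp add: cdf_def)
  next
    case False
    then have "?I \<subseteq> {..<Sup ?I}"
      using cSup_upper[OF _ bdd] by (auto simp: order_less_le)
    then have "measure M ?I \<le> measure M {..<Sup ?I}"
      by (intro finite_measure_mono) auto
    also have "\<dots> \<le> c"
      using below by (intro tendsto_upperbound[OF cdf_at_left])
        (auto simp: eventually_at_left_field intro!: exI[of _ "Sup ?I - 1"] less_imp_le)
    finally show ?thesis .
  qed
qed

text \<open>\<open>A\<close> is fixed before \<open>p\<close>, so one event serves every planner,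
  even one designed after seeing the calibration data. A Bochner integral of a nonmeasurable
  function is 0 by convention; the measurability premise makes the integral a genuine
  expectation.\<close>

theorem proposition2:
  fixes R :: "('e, 's, 'a, 'x) robot_system"
    and D :: "'e measure"
    and P :: "'w measure"
    and Env :: "nat \<Rightarrow> 'w \<Rightarrow> 'e"
    and N v :: nat
    and \<delta> \<epsilon> \<epsilon>' :: real
    and \<phi> :: "'w \<Rightarrow> 'e \<Rightarrow> 's \<Rightarrow> 'x set"
  assumes "valid_system R"
    and "prob_space D" and "space D = envs R"
    and "nonconformity R \<in> borel_measurable D"
    and "prob_space P"
    and "prob_space.indep_vars P (\<lambda>_. D) Env {1..N}"
    and "\<And>i. i \<in> {1..N} \<Longrightarrow> distr P D (Env i) = D"
    and "0 < \<delta>" and "\<delta> < 1"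
    and "0 < \<epsilon>" and "\<epsilon> < 1"
    and "int v = \<lfloor>(real N + 1) * \<epsilon>'\<rfloor>" and "1 \<le> v" and "v \<le> N"
    and "quantile (beta_distribution (real (N + 1 - v)) (real v)) \<delta> \<ge> 1 - \<epsilon>"
  defines "\<phi> \<equiv> \<lambda>\<omega>. calibrated_perception R (calibrated_threshold R N \<epsilon>' (\<lambda>i. Env i \<omega>))"
  shows "\<exists>A\<in>sets P. measure P A \<ge> 1 - \<delta> \<and>
           (\<forall>\<omega>\<in>A. \<forall>p :: ('s, 'a, 'x) planner.
              safe_planner R (\<phi> \<omega>) p \<longrightarrow>
              safe_cost R (composed_policy R (\<phi> \<omega>) p) \<in> borel_measurable D \<longrightarrow>
              (\<integral>E. safe_cost R (composed_policy R (\<phi> \<omega>) p) E \<partial>D) \<le> \<epsilon>)"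
proof -
  interpret D: prob_space D by fact
  interpret P: prob_space P by fact
  let ?U = "nonconformity R"
  define k where "k = N + 1 - v"
  define M where "M = distr D borel ?U"
  interpret M: real_distribution M
    unfolding M_def using assms(4) by (rule D.real_distribution_distr)
  \<comment> \<open>The unsuitable thresholds: a new score exceeds such an \<open>x\<close> with
    probability more than \<epsilon>.\<close>
  define I where "I = {x. cdf M x < 1 - \<epsilon>}"
  \<comment> \<open>Pulled back to environments, so that counting applies to the independent
    \<open>Env i\<close> directly.\<close>
  define B where "B = ?U -` I \<inter> space D"
  have k: "1 \<le> k" "k \<le> N" "N + 1 - k = v"
    using assms(13,14) by (auto simp: k_def)
  have "I \<in> sets borel"
  proof -
    have "cdf M \<in> borel_measurable borel"
      by (intro borel_measurable_mono monoI M.cdf_nondecreasing)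
    then show ?thesis unfolding I_def by measurable
  qed
  then have B: "B \<in> sets D" unfolding B_def using assms(4) by measurable
  have B_le: "measure D B \<le> 1 - \<epsilon>"
  proof -
    have "measure D B = measure M I"
      unfolding B_def M_def by (rule measure_distr[symmetric]) fact+
    also have "\<dots> \<le> 1 - \<epsilon>"
      unfolding I_def using assms(10,11) by (intro M.measure_cdf_less_le) auto
    finally show ?thesis .
  qed
  have Env: "Env i \<in> measurable P D" if "i \<in> {1..N}" for i
    using assms(6) that unfolding P.indep_vars_def by blast
  have prob_B: "measure P (Env i -` B \<inter> space P) = measure D B" if "i \<in> {1..N}" for i
    using measure_distr[OF Env[OF that] B] assms(7)[OF that] by simp
  let ?bad = "{\<omega>\<in>space P. k \<le> card {i\<in>{1..N}. Env i \<omega> \<in> B}}"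
  have "{1..N} \<noteq> {}" using k by auto
  note count = P.prob_count_ge_eq_binomial_tail[OF assms(6) finite_atLeastAtMost this B prob_B, of k]
  have bad: "?bad \<in> sets P" by (rule count(1)) auto
  have "measure P ?bad = binomial_tail N k (measure D B)"
    using count(2) by simp
  also have "\<dots> \<le> binomial_tail N k (1 - \<epsilon>)"
    using k B_le assms(10) by (intro binomial_tail_mono) auto
  also have "\<dots> \<le> \<delta>"
    using k assms(8,10,11,15) by (intro binomial_tail_le_of_beta_quantile) (auto simp: k_def)
  finally have bad_le: "measure P ?bad \<le> \<delta>" .
  define A where "A = space P - ?bad"
  have A: "A \<in> sets P"
    unfolding A_def using bad by (rule sets.compl_sets)
  have measure_A: "1 - \<delta> \<le> measure P A"
    unfolding A_def P.prob_compl[OF bad] using bad_le by linarith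
  have safe: "(\<integral>E. safe_cost R (composed_policy R (\<phi> \<omega>) p) E \<partial>D) \<le> \<epsilon>"
    if \<omega>: "\<omega> \<in> A" and p: "safe_planner R (\<phi> \<omega>) p"
    for \<omega> and p :: "('s, 'a, 'x) planner"
  proof -
    define q where "q = calibrated_threshold R N \<epsilon>' (\<lambda>i. Env i \<omega>)"
    let ?xs = "map (\<lambda>i. ?U (Env i \<omega>)) [1..<N + 1]"
    have \<phi>: "\<phi> \<omega> = calibrated_perception R q" unfolding \<phi>_def q_def by simp
    have q: "q = kth_smallest k ?xs"
      unfolding q_def calibrated_threshold_def nat_ceiling_one_minus[OF assms(12)] k_def ..
    have "q \<notin> I"
      unfolding q
    proof (rule kth_smallest_not_in_downset)
      show "y \<in> I" if "x \<in> I" "y \<le> x" for x y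
        using that M.cdf_nondecreasing[of y x] by (simp add: I_def)
      \<comment> \<open>Scores may coincide, so the list entries are counted through their indices,
        which are distinct.\<close>
      have "length (filter (\<lambda>x. x \<in> I) ?xs) = card {i\<in>{1..N}. ?U (Env i \<omega>) \<in> I}"
      proof -
        have "length (filter (\<lambda>x. x \<in> I) ?xs) = length (filter (\<lambda>i. ?U (Env i \<omega>) \<in> I) [1..<N + 1])"
          by (simp add: filter_map o_def del: upt_Suc)
        also have "\<dots> = card (set (filter (\<lambda>i. ?U (Env i \<omega>) \<in> I) [1..<N + 1]))"
          by (rule distinct_card[symmetric]) simp
        also have "set (filter (\<lambda>i. ?U (Env i \<omega>) \<in> I) [1..<N + 1]) = {i\<in>{1..N}. ?U (Env i \<omega>) \<in> I}"
          by auto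
        finally show ?thesis .
      qed
      also have "{i\<in>{1..N}. ?U (Env i \<omega>) \<in> I} = {i\<in>{1..N}. Env i \<omega> \<in> B}"
        using \<omega> Env by (auto simp: A_def B_def dest: measurable_space)
      finally show "length (filter (\<lambda>x. x \<in> I) ?xs) < k"
        using \<omega> unfolding A_def by force
    qed (use k in auto)
    let ?G = "{E\<in>space D. q < ?U E}"
    have G: "?G \<in> sets D" using assms(4) by measurable
    have "(\<integral>E. safe_cost R (composed_policy R (\<phi> \<omega>) p) E \<partial>D) \<le> (\<integral>E. indicator ?G E \<partial>D)"
    proof (rule integral_mono')
      show "integrable D (indicator ?G :: _ \<Rightarrow> real)"
        using G by (simp add: D.emeasure_eq_measure)
      fix E assume E: "E \<in> space D"
      then have "safe_cost R (composed_policy R (\<phi> \<omega>) p) E = 0" if "?U E \<le> q"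
        using that p assms(1,3) unfolding \<phi> by (intro safe_cost_eq_0) auto
      then show "safe_cost R (composed_policy R (\<phi> \<omega>) p) E \<le> indicator ?G E"
        using E by (cases "?U E \<le> q") (auto simp: safe_cost_def)
    qed simp
    also have "\<dots> = measure D ?G" using G by simp
    also have "?G = space D - (?U -` {..q} \<inter> space D)" by auto
    also have "measure D \<dots> = 1 - cdf M q"
      using assms(4) by (subst D.prob_compl) (auto simp: cdf_def M_def measure_distr)
    also have "\<dots> \<le> \<epsilon>" using \<open>q \<notin> I\<close> by (simp add: I_def)
    finally show "(\<integral>E. safe_cost R (composed_policy R (\<phi> \<omega>) p) E \<partial>D) \<le> \<epsilon>" .
  qed
  show ?thesis
    using measure_A safe by (intro bexI[OF _ A]) blast
qed

end
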